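(* Let $K$ be an infinite field, and let $\Gamma$ be the standard interpretation of the group $H(K)$ in the field $K$. Then there is no interpretation $\Delta$ of the field $K$ in the group $H(K)$, even allowing parameters, such that $\Gamma$ and $\Delta$ together form a bi-interpretation (even allowing parameters) between the field $K$ and the group $H(K)$.
   Context: For a field $K$, the Heisenberg group $H(K)=\mathrm{UT}_3(K)$ is the group of upper unitriangular $3\times 3$ matrices $$(a,b,c)_K=\begin{pmatrix}1&a&c\\0&1&b\\0&0&1\end{pmatrix},\quad a,b,c\in K.$$ The standard interpretation $\Gamma$ of $H(K)$ in $K$ has universe $K^3$, with $(a,b,c)\in K^3$ representing the matrix $(a,b,c)_K$ and the group operation given by the matrix multiplication, $(a,b,c)(a',b',c')=(a+a',b+b',c+c'+ab')$. Fields are structures in the language of rings, groups are structures in the pure language of groups. Given an interpretation $\Gamma$ of a structure $\mathcal N$ in a structure $\mathcal M$ and an interpretation $\Delta$ of $\mathcal M$ in $\mathcal N$ (in the usual model-theoretic sense, on definable quotients of finite Cartesian powers), the composites yield an interpreted copy of $\mathcal M$ in $\mathcal M$ and an interpreted copy of $\mathcal N$ in $\mathcal N$. The pair $(\Gamma,\Delta)$ is a bi-interpretation if the natural isomorphism between $\mathcal M$ and its copy is definable in $\mathcal M$ and the natural isomorphism between $\mathcal N$ and its copy is definable in $\mathcal N$. "Allowing parameters" means that all formulas involved may use finitely many parameters from the respective structures. *)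

theory Defs
  imports "HOL-Analysis.Analysis" "HOL-Algebra.Group"
begin

section \<open>First-order logic over algebraic languages\<close>

text \<open>
  The languages of rings and of groups have no relation symbols apart from equality, so a language
  is a type of function symbols together with an arity for each of them. The arity is stored in
  the structure; a structure interprets \<open>f\<close> on argument lists of length \<open>arity f\<close>, and
  \<open>wf_term\<close>, \<open>wf_form\<close> rule out every other use of \<open>f\<close>.
\<close>

datatype 'f fo_term = Var nat | App 'f "'f fo_term list"

datatype 'f fo_form =
    Eq "'f fo_term" "'f fo_term"
  | Neg "'f fo_form"
  | Conj "'f fo_form" "'f fo_form"
  | Ex nat "'f fo_form"

record ('f, 'a) struct =
  universe :: "'a set"
  arity :: "'f \<Rightarrow> nat"
  interp :: "'f \<Rightarrow> 'a list \<Rightarrow> 'a"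

fun wf_term :: "('f \<Rightarrow> nat) \<Rightarrow> 'f fo_term \<Rightarrow> bool" where
  "wf_term ar (Var i) \<longleftrightarrow> True"
| "wf_term ar (App f ts) \<longleftrightarrow> length ts = ar f \<and> (\<forall>t\<in>set ts. wf_term ar t)"

primrec wf_form :: "('f \<Rightarrow> nat) \<Rightarrow> 'f fo_form \<Rightarrow> bool" where
  "wf_form ar (Eq s t) \<longleftrightarrow> wf_term ar s \<and> wf_term ar t"
| "wf_form ar (Neg \<phi>) \<longleftrightarrow> wf_form ar \<phi>"
| "wf_form ar (Conj \<phi> \<psi>) \<longleftrightarrow> wf_form ar \<phi> \<and> wf_form ar \<psi>"
| "wf_form ar (Ex i \<phi>) \<longleftrightarrow> wf_form ar \<phi>"

fun fv_term :: "'f fo_term \<Rightarrow> nat set" where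
  "fv_term (Var i) = {i}"
| "fv_term (App f ts) = (\<Union>t\<in>set ts. fv_term t)"

primrec fv_form :: "'f fo_form \<Rightarrow> nat set" where
  "fv_form (Eq s t) = fv_term s \<union> fv_term t"
| "fv_form (Neg \<phi>) = fv_form \<phi>"
| "fv_form (Conj \<phi> \<psi>) = fv_form \<phi> \<union> fv_form \<psi>"
| "fv_form (Ex i \<phi>) = fv_form \<phi> - {i}"

primrec eval_term :: "('f, 'a) struct \<Rightarrow> (nat \<Rightarrow> 'a) \<Rightarrow> 'f fo_term \<Rightarrow> 'a" where
  "eval_term M s (Var i) = s i"
| "eval_term M s (App f ts) = interp M f (map (eval_term M s) ts)"

primrec sat :: "('f, 'a) struct \<Rightarrow> (nat \<Rightarrow> 'a) \<Rightarrow> 'f fo_form \<Rightarrow> bool" where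
  "sat M s (Eq t u) \<longleftrightarrow> eval_term M s t = eval_term M s u"
| "sat M s (Neg \<phi>) \<longleftrightarrow> \<not> sat M s \<phi>"
| "sat M s (Conj \<phi> \<psi>) \<longleftrightarrow> sat M s \<phi> \<and> sat M s \<psi>"
| "sat M s (Ex i \<phi>) \<longleftrightarrow> (\<exists>a\<in>universe M. sat M (s(i := a)) \<phi>)"

text \<open>
  \<open>X\<close> is a subset of the \<open>n\<close>-th Cartesian power (tuples are lists of length \<open>n\<close>) that is definable
  with parameters: the variables \<open>0, \<dots>, n - 1\<close> stand for the tuple, and the following ones for the
  finitely many parameters \<open>ps\<close>.
\<close>
definition definable :: "('f, 'a) struct \<Rightarrow> nat \<Rightarrow> 'a list set \<Rightarrow> bool" where
  "definable M n X \<longleftrightarrow>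
     (\<exists>\<phi> ps. wf_form (arity M) \<phi> \<and> set ps \<subseteq> universe M \<and> fv_form \<phi> \<subseteq> {..<n + length ps} \<and>
        X = {xs. length xs = n \<and> set xs \<subseteq> universe M \<and> sat M (\<lambda>i. (xs @ ps) ! i) \<phi>})"


section \<open>Interpretations and bi-interpretations\<close>

text \<open>
  An interpretation of \<open>N\<close> (with elements in \<open>'b\<close>) in \<open>M\<close> (with elements in \<open>'a\<close>) is given by a
  dimension, a definable set of tuples, and a coordinate map from that set onto the universe of
  \<open>N\<close>. The interpreted copy of \<open>N\<close> is the quotient of \<open>idom\<close> by the kernel of \<open>coord\<close>, and \<open>coord\<close>
  induces the isomorphism of this copy with \<open>N\<close>.
\<close>
record ('a, 'b) interpr =
  dim :: nat
  idom :: "'a list set"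
  coord :: "'a list \<Rightarrow> 'b"

definition is_interpretation ::
  "('f, 'a) struct \<Rightarrow> ('g, 'b) struct \<Rightarrow> ('a, 'b) interpr \<Rightarrow> bool" where
  "is_interpretation M N \<Gamma> \<longleftrightarrow>
     definable M (dim \<Gamma>) (idom \<Gamma>) \<and>
     coord \<Gamma> ` idom \<Gamma> = universe N \<and>
     definable M (2 * dim \<Gamma>)
       {xs @ ys | xs ys. xs \<in> idom \<Gamma> \<and> ys \<in> idom \<Gamma> \<and> coord \<Gamma> xs = coord \<Gamma> ys} \<and>
     (\<forall>g. definable M ((arity N g + 1) * dim \<Gamma>)
       {concat xss @ ys | xss ys. length xss = arity N g \<and> set xss \<subseteq> idom \<Gamma> \<and> ys \<in> idom \<Gamma> \<and>
          interp N g (map (coord \<Gamma>) xss) = coord \<Gamma> ys})"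

text \<open>\<open>chunks n m xs\<close> cuts a list of length \<open>m * n\<close> into \<open>m\<close> consecutive tuples of length \<open>n\<close>.\<close>
definition chunks :: "nat \<Rightarrow> nat \<Rightarrow> 'a list \<Rightarrow> 'a list list" where
  "chunks n m xs = map (\<lambda>i. take n (drop (i * n) xs)) [0..<m]"

text \<open>
  The composite of an interpretation \<open>\<Gamma>\<close> of \<open>N\<close> in \<open>M\<close> with an interpretation \<open>\<Delta>\<close> of \<open>P\<close> in \<open>N\<close>:
  an interpretation of \<open>P\<close> in \<open>M\<close>.
\<close>
definition composite :: "('a, 'b) interpr \<Rightarrow> ('b, 'c) interpr \<Rightarrow> ('a, 'c) interpr" where
  "composite \<Gamma> \<Delta> =
     \<lparr>dim = dim \<Delta> * dim \<Gamma>,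
      idom = {xs. length xs = dim \<Delta> * dim \<Gamma> \<and> set (chunks (dim \<Gamma>) (dim \<Delta>) xs) \<subseteq> idom \<Gamma> \<and>
                  map (coord \<Gamma>) (chunks (dim \<Gamma>) (dim \<Delta>) xs) \<in> idom \<Delta>},
      coord = (\<lambda>xs. coord \<Delta> (map (coord \<Gamma>) (chunks (dim \<Gamma>) (dim \<Delta>) xs)))\<rparr>"

text \<open>
  For an interpretation \<open>\<Theta>\<close> of \<open>M\<close> in itself, definability in \<open>M\<close> of the natural isomorphism between
  \<open>M\<close> and its copy: as usual for maps to or from definable quotients, it is the relation between
  representing tuples and elements of \<open>M\<close> that has to be definable.
\<close>
definition natural_iso_definable :: "('f, 'a) struct \<Rightarrow> ('a, 'a) interpr \<Rightarrow> bool" where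
  "natural_iso_definable M \<Theta> \<longleftrightarrow>
     definable M (dim \<Theta> + 1) {xs @ [coord \<Theta> xs] | xs. xs \<in> idom \<Theta>}"

definition bi_interpretation ::
  "('f, 'a) struct \<Rightarrow> ('g, 'b) struct \<Rightarrow> ('a, 'b) interpr \<Rightarrow> ('b, 'a) interpr \<Rightarrow> bool" where
  "bi_interpretation M N \<Gamma> \<Delta> \<longleftrightarrow>
     is_interpretation M N \<Gamma> \<and> is_interpretation N M \<Delta> \<and>
     natural_iso_definable M (composite \<Gamma> \<Delta>) \<and>
     natural_iso_definable N (composite \<Delta> \<Gamma>)"


section \<open>Fields and groups as structures\<close>

datatype ring_sym = RZero | ROne | RUminus | RPlus | RTimes

fun ring_arity :: "ring_sym \<Rightarrow> nat" where
  "ring_arity RZero = 0"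
| "ring_arity ROne = 0"
| "ring_arity RUminus = 1"
| "ring_arity RPlus = 2"
| "ring_arity RTimes = 2"

fun ring_interp :: "ring_sym \<Rightarrow> 'a::field list \<Rightarrow> 'a" where
  "ring_interp RZero [] = 0"
| "ring_interp ROne [] = 1"
| "ring_interp RUminus [x] = - x"
| "ring_interp RPlus [x, y] = x + y"
| "ring_interp RTimes [x, y] = x * y"

definition field_struct :: "(ring_sym, 'a::field) struct" where
  "field_struct = \<lparr>universe = UNIV, arity = ring_arity, interp = ring_interp\<rparr>"

datatype group_sym = GOne | GInv | GMult

fun group_arity :: "group_sym \<Rightarrow> nat" where
  "group_arity GOne = 0"
| "group_arity GInv = 1"
| "group_arity GMult = 2"

fun group_interp :: "('g, 'm) monoid_scheme \<Rightarrow> group_sym \<Rightarrow> 'g list \<Rightarrow> 'g" where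
  "group_interp G GOne [] = \<one>\<^bsub>G\<^esub>"
| "group_interp G GInv [x] = inv\<^bsub>G\<^esub> x"
| "group_interp G GMult [x, y] = x \<otimes>\<^bsub>G\<^esub> y"

definition group_struct :: "('g, 'm) monoid_scheme \<Rightarrow> (group_sym, 'g) struct" where
  "group_struct G = \<lparr>universe = carrier G, arity = group_arity, interp = group_interp G\<rparr>"


section \<open>The Heisenberg group and its standard interpretation\<close>

definition heis :: "'a::field \<Rightarrow> 'a \<Rightarrow> 'a \<Rightarrow> 'a ^ 3 ^ 3" where
  "heis a b c = vector [vector [1, a, c],
                        vector [0, 1, b],
                        vector [0, 0, 1]]"

definition heisenberg_group :: "('a::field ^ 3 ^ 3) monoid" where
  "heisenberg_group = \<lparr>carrier = {heis a b c | a b c. True}, monoid.mult = (**), one = mat 1\<rparr>"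

definition standard_interpretation :: "('a::field, 'a ^ 3 ^ 3) interpr" where
  "standard_interpretation =
     \<lparr>dim = 3, idom = {xs. length xs = 3}, coord = (\<lambda>xs. heis (xs ! 0) (xs ! 1) (xs ! 2))\<rparr>"

lemma heis_mult: "heis a b c ** heis a' b' c' = heis (a + a') (b + b') (c + c' + a * b')"
  by (simp add: heis_def matrix_matrix_mult_def vec_eq_iff forall_3 sum_3)

lemma heis_one: "mat 1 = heis 0 0 0"
  by (simp add: heis_def mat_def vec_eq_iff forall_3)

lemma heis_inject: "heis a b c = heis a' b' c' \<longleftrightarrow> a = a' \<and> b = b' \<and> c = c'"
  by (auto simp: heis_def vec_eq_iff forall_3)

lemma group_heisenberg: "group (heisenberg_group :: ('a::field ^ 3 ^ 3) monoid)"
proof (rule groupI)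
  fix x :: "'a ^ 3 ^ 3" assume "x \<in> carrier heisenberg_group"
  then obtain a b c where x: "x = heis a b c" by (auto simp: heisenberg_group_def)
  have "heis (- a) (- b) (a * b - c) \<otimes>\<^bsub>heisenberg_group\<^esub> x = \<one>\<^bsub>heisenberg_group\<^esub>"
    by (simp add: x heisenberg_group_def heis_mult heis_one heis_inject)
  then show "\<exists>y\<in>carrier heisenberg_group. y \<otimes>\<^bsub>heisenberg_group\<^esub> x = \<one>\<^bsub>heisenberg_group\<^esub>"
    by (rule bexI) (auto simp: heisenberg_group_def)
qed (auto simp: heisenberg_group_def heis_one heis_mult heis_inject algebra_simps)

lemma heis_inv: "inv\<^bsub>heisenberg_group\<^esub> (heis a b c) = heis (- a) (- b) (a * b - c)"
proof -
  interpret group "heisenberg_group :: ('a ^ 3 ^ 3) monoid" by (rule group_heisenberg)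
  show ?thesis
    by (rule inv_equality)
       (auto simp: heisenberg_group_def heis_mult heis_one heis_inject)
qed

lemma length_3_iff: "length xs = 3 \<longleftrightarrow> (\<exists>a b c. xs = [a, b, c])"
  by (auto simp: numeral_3_eq_3 length_Suc_conv)

lemma length_6_iff: "length xs = 6 \<longleftrightarrow> (\<exists>a b c d e f. xs = [a, b, c, d, e, f])"
  by (auto simp: eval_nat_numeral length_Suc_conv)

lemma length_9_iff:
  "length xs = 9 \<longleftrightarrow> (\<exists>a b c d e f g h i. xs = [a, b, c, d, e, f, g, h, i])"
  by (auto simp: eval_nat_numeral length_Suc_conv)

lemma definableI:
  assumes "wf_form (arity M) \<phi>" "fv_form \<phi> \<subseteq> {..<n}"
    and "X = {xs. length xs = n \<and> set xs \<subseteq> universe M \<and> sat M (\<lambda>i. xs ! i) \<phi>}"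
  shows "definable M n X"
  unfolding definable_def
  by (rule exI[of _ \<phi>], rule exI[of _ "[]"]) (use assms in auto)

lemma is_interpretation_standard:
  "is_interpretation field_struct (group_struct heisenberg_group)
     (standard_interpretation :: ('a::field, 'a ^ 3 ^ 3) interpr)"
  (is "is_interpretation ?K ?H ?G")
proof -
  have dom: "definable ?K 3 {xs. length xs = 3}"
    by (rule definableI[where \<phi> = "Eq (Var 0) (Var 0)"]) (auto simp: field_struct_def)
  have surj: "coord ?G ` idom ?G = universe ?H"
  proof -
    have "heis a b c \<in> coord ?G ` idom ?G" for a b c
      by (rule image_eqI[of _ _ "[a, b, c]"])
         (auto simp: standard_interpretation_def eval_nat_numeral)
    then show ?thesis
      by (auto simp: standard_interpretation_def group_struct_def heisenberg_group_def)
  qed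
  have ker: "definable ?K 6
      {xs @ ys | xs ys. xs \<in> idom ?G \<and> ys \<in> idom ?G \<and> coord ?G xs = coord ?G ys}"
  proof -
    have set_eq: "{xs @ ys | xs ys. xs \<in> idom ?G \<and> ys \<in> idom ?G \<and> coord ?G xs = coord ?G ys} =
      {[a, b, c, a, b, c] | a b c. True}" (is "?L = ?R")
    proof
      show "?L \<subseteq> ?R"
        by (auto simp: standard_interpretation_def length_3_iff heis_inject)
      show "?R \<subseteq> ?L"
      proof
        fix zs assume "zs \<in> ?R"
        then obtain a b c where "zs = [a, b, c, a, b, c]" by blast
        then show "zs \<in> ?L"
          by (intro CollectI exI[of _ "[a, b, c]"]) (auto simp: standard_interpretation_def)
      qed
    qed
    show ?thesis unfolding set_eq
      by (rule definableI[where \<phi> = "Conj (Eq (Var 3) (Var 0))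
            (Conj (Eq (Var 4) (Var 1)) (Eq (Var 5) (Var 2)))"])
         (auto simp: field_struct_def length_6_iff)
  qed
  have op: "definable ?K ((arity ?H g + 1) * 3)
      {concat xss @ ys | xss ys. length xss = arity ?H g \<and> set xss \<subseteq> idom ?G \<and> ys \<in> idom ?G \<and>
         interp ?H g (map (coord ?G) xss) = coord ?G ys}" for g
  proof (cases g)
    case GOne
    show ?thesis
      by (rule definableI[where \<phi> = "Conj (Eq (Var 0) (App RZero []))
            (Conj (Eq (Var 1) (App RZero [])) (Eq (Var 2) (App RZero [])))"])
         (auto simp: GOne field_struct_def group_struct_def standard_interpretation_def
            length_3_iff heis_inject heisenberg_group_def heis_one)
  next
    case GInv
    have inv: "inv\<^bsub>heisenberg_group\<^esub> (heis a b c) = heis a' b' c' \<longleftrightarrow>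
        a' = - a \<and> b' = - b \<and> c' = a * b + - c" for a b c a' b' c' :: 'a
      by (auto simp: heis_inv heis_inject)
    have set_eq: "{concat xss @ ys | xss ys. length xss = arity ?H g \<and> set xss \<subseteq> idom ?G \<and>
         ys \<in> idom ?G \<and> interp ?H g (map (coord ?G) xss) = coord ?G ys} =
      {[a, b, c, - a, - b, a * b + - c] | a b c. True}" (is "?L = ?R")
    proof
      show "?L \<subseteq> ?R"
        by (auto simp: GInv group_struct_def standard_interpretation_def length_Suc_conv
            length_3_iff inv)
      show "?R \<subseteq> ?L"
      proof
        fix zs assume "zs \<in> ?R"
        then obtain a b c where "zs = [a, b, c, - a, - b, a * b + - c]" by blast
        then show "zs \<in> ?L"
          by (intro CollectI exI[of _ "[[a, b, c]]"] exI[of _ "[- a, - b, a * b + - c]"])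
             (auto simp: GInv group_struct_def standard_interpretation_def inv)
      qed
    qed
    show ?thesis unfolding set_eq
      by (rule definableI[where \<phi> = "Conj (Eq (Var 3) (App RUminus [Var 0]))
            (Conj (Eq (Var 4) (App RUminus [Var 1]))
              (Eq (Var 5) (App RPlus [App RTimes [Var 0, Var 1], App RUminus [Var 2]])))"])
         (auto simp: GInv field_struct_def group_struct_def length_6_iff)
  next
    case GMult
    have mul: "heis a b c \<otimes>\<^bsub>heisenberg_group\<^esub> heis d e f = heis a' b' c' \<longleftrightarrow>
        a' = a + d \<and> b' = b + e \<and> c' = (c + f) + a * e" for a b c d e f a' b' c' :: 'a
      by (auto simp: heisenberg_group_def heis_mult heis_inject)
    have set_eq: "{concat xss @ ys | xss ys. length xss = arity ?H g \<and> set xss \<subseteq> idom ?G \<and>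
         ys \<in> idom ?G \<and> interp ?H g (map (coord ?G) xss) = coord ?G ys} =
      {[a, b, c, d, e, f, a + d, b + e, (c + f) + a * e] | a b c d e f. True}" (is "?L = ?R")
    proof
      show "?L \<subseteq> ?R"
        by (auto simp: GMult group_struct_def standard_interpretation_def
            numeral_2_eq_2 length_Suc_conv length_3_iff mul)
      show "?R \<subseteq> ?L"
      proof
        fix zs assume "zs \<in> ?R"
        then obtain a b c d e f
          where "zs = [a, b, c, d, e, f, a + d, b + e, (c + f) + a * e]" by blast
        then show "zs \<in> ?L"
          by (intro CollectI exI[of _ "[[a, b, c], [d, e, f]]"]
                exI[of _ "[a + d, b + e, (c + f) + a * e]"])
             (auto simp: GMult group_struct_def standard_interpretation_def mul)
      qed
    qed
    show ?thesis unfolding set_eq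
      by (rule definableI[where \<phi> = "Conj (Eq (Var 6) (App RPlus [Var 0, Var 3]))
            (Conj (Eq (Var 7) (App RPlus [Var 1, Var 4]))
              (Eq (Var 8) (App RPlus [App RPlus [Var 2, Var 5], App RTimes [Var 0, Var 4]])))"])
         (auto simp: GMult field_struct_def group_struct_def length_9_iff)
  qed
  show ?thesis
    using dom surj ker op unfolding is_interpretation_def
    by (simp add: standard_interpretation_def)
qed

lemma chunks_concat:
  assumes "length xss = m" "\<forall>xs\<in>set xss. length xs = n"
  shows "chunks n m (concat xss) = xss"
  using assms
proof (induction xss arbitrary: m)
  case (Cons xs xss)
  then have "chunks n (length xss) (concat xss) = xss" by simp
  moreover have "chunks n (Suc k) (xs @ ys) = xs # chunks n k ys" if "length xs = n" for k ys
    using that by (simp add: chunks_def upt_conv_Cons map_Suc_upt[symmetric] del: upt_Suc)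
  ultimately show ?case using Cons.prems by auto
qed (simp add: chunks_def)

end

theory Submission
  imports Defs "HOL-Library.Function_Algebras"
begin

text \<open>
  Let \<open>U\<close> be a free ultrafilter on the naturals, and consider the sequences in \<open>K\<close> as a vector space
  over \<open>K\<close>. An injective sequence \<open>\<alpha>\<close> lies outside the subspace of the sequences that are constant
  \<open>U\<close>-almost everywhere, so there is a linear functional \<open>\<phi>\<close> with values in \<open>K\<close> that vanishes on this
  subspace but not at \<open>\<alpha>\<close>. Then \<open>(a, b, c) \<mapsto> (a, b, c + \<phi> a)\<close> is an automorphism of the group of
  sequences in \<open>H(K)\<close>; it induces an automorphism of the ultrapower that fixes the diagonal copy of
  \<open>H(K)\<close>, hence preserves every relation definable in \<open>H(K)\<close> with parameters.
  Were the isomorphism between \<open>H(K)\<close> and its copy definable, so would be the set of all \<open>(a, a, a)\<close>: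
  it consists of the elements whose three coordinates are represented by the same tuple. But
  the automorphism moves \<open>(\<alpha>, \<alpha>, \<alpha>)\<close> to \<open>(\<alpha>, \<alpha>, \<alpha> + \<phi> \<alpha>)\<close>.
\<close>

section \<open>Ultrafilters and linear functionals\<close>

lemma exists_ultrafilter_le:
  assumes "F \<noteq> bot"
  obtains U where "U \<noteq> bot" "U \<le> F"
    "\<And>P. (\<forall>\<^sub>F x in U. \<not> P x) \<longleftrightarrow> \<not> (\<forall>\<^sub>F x in U. P x)"
proof -
  \<comment> \<open>Zorn's lemma is applied to the proper filters below \<open>F\<close>, with the
    order reversed: a minimal proper filter is an ultrafilter.\<close>
  define A where "A = {G. G \<noteq> bot \<and> G \<le> F}"
  have "\<exists>U\<in>A. \<forall>G\<in>A. G \<le> U \<longrightarrow> G = U"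
  proof (rule predicate_Zorn)
    show "partial_order_on A (relation_of (\<lambda>U G. G \<le> U) A)"
      by (rule partial_order_on_relation_ofI) auto
    fix C assume C: "C \<in> Chains (relation_of (\<lambda>U G. G \<le> U) A)"
    then have sub: "C \<subseteq> A" and lin: "\<And>G H. G \<in> C \<Longrightarrow> H \<in> C \<Longrightarrow> G \<le> H \<or> H \<le> G"
      by (auto simp: Chains_def relation_of_def)
    show "\<exists>u\<in>A. \<forall>a\<in>C. u \<le> a"
    proof (cases "C = {}")
      case True
      then show ?thesis using assms by (auto simp: A_def)
    next
      case False
      \<comment> \<open>A chain is directed downwards, so whatever holds eventually in
        \<open>Inf C\<close> already does so in one member of \<open>C\<close>. Hence
        \<open>Inf C\<close> is proper because all members are.\<close>
      have "\<exists>x\<in>C. x \<le> inf G H" if "G \<in> C" "H \<in> C" for G H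
        using lin[OF that] that by auto
      then have "eventually P (Inf C) \<longleftrightarrow> (\<exists>G\<in>C. eventually P G)" for P
        by (rule eventually_Inf_base[OF False])
      then have "Inf C \<noteq> bot"
        using sub by (auto simp: trivial_limit_def A_def)
      moreover obtain G where "G \<in> C" using False by blast
      then have "Inf C \<le> F"
        using sub by (auto simp: A_def intro: Inf_lower2)
      ultimately show ?thesis by (auto simp: A_def intro: Inf_lower)
    qed
  qed
  then obtain U where U: "U \<noteq> bot" "U \<le> F"
    and min: "\<And>G. G \<noteq> bot \<Longrightarrow> G \<le> F \<Longrightarrow> G \<le> U \<Longrightarrow> G = U"
    by (auto simp: A_def)
  have "(\<forall>\<^sub>F x in U. \<not> P x) \<longleftrightarrow> \<not> (\<forall>\<^sub>F x in U. P x)" for P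
  proof
    show "\<not> (\<forall>\<^sub>F x in U. P x)" if "\<forall>\<^sub>F x in U. \<not> P x"
    proof
      assume "\<forall>\<^sub>F x in U. P x"
      with that have "\<forall>\<^sub>F x in U. False" by eventually_elim simp
      with U show False by (simp add: trivial_limit_def)
    qed
    show "\<forall>\<^sub>F x in U. \<not> P x" if "\<not> (\<forall>\<^sub>F x in U. P x)"
    proof -
      \<comment> \<open>Since \<open>P\<close> does not hold eventually, adjoining its complement to
        \<open>U\<close> keeps the filter proper; minimality then says that the complement belonged
        to \<open>U\<close> already.\<close>
      define G where "G = inf U (principal {x. \<not> P x})"
      have "G \<noteq> bot"
        using that by (simp add: G_def trivial_limit_def eventually_inf_principal)
      moreover have "G \<le> U" by (simp add: G_def)
      ultimately have "G = U" using U by (intro min) auto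
      moreover have "\<forall>\<^sub>F x in G. \<not> P x" by (simp add: G_def eventually_inf_principal)
      ultimately show ?thesis by simp
    qed
  qed
  with U show ?thesis by (rule that)
qed

text \<open>A basis \<open>B\<close> of \<open>W\<close> stays independent when \<open>v\<close> is
  added, so the values 1 at \<open>v\<close> and 0 on \<open>B\<close> extend linearly to the whole
  space.\<close>

lemma (in vector_space) exists_linear_functional:
  assumes "subspace W" "v \<notin> W"
  obtains \<phi> where "Vector_Spaces.linear scale (*) \<phi>" "\<phi> v = 1" "\<And>w. w \<in> W \<Longrightarrow> \<phi> w = 0"
proof -
  interpret S: vector_space "(*) :: 'a \<Rightarrow> 'a \<Rightarrow> 'a"
    by unfold_locales (simp_all add: algebra_simps)
  interpret P: vector_space_pair scale "(*) :: 'a \<Rightarrow> 'a \<Rightarrow> 'a" ..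
  obtain B where B: "B \<subseteq> W" "independent B" "W \<subseteq> span B"
    by (rule maximal_independent_subset)
  have "span B \<subseteq> W" using assms(1) B(1) by (rule span_minimal[rotated])
  with assms(2) B(2) have "independent (insert v B)"
    by (meson independent_insertI subsetD)
  from P.linear_independent_extend[OF this, of "\<lambda>x. if x = v then 1 else 0"]
  obtain \<phi> where \<phi>: "Vector_Spaces.linear scale (*) \<phi>"
    "\<forall>x\<in>insert v B. \<phi> x = (if x = v then 1 else 0)" by blast
  have "\<phi> x = 0" if "x \<in> B" for x
    using \<phi>(2) that B(1) assms(2) by auto
  then have "\<phi> w = 0" if "w \<in> W" for w
    using P.linear_eq_0_on_span[OF \<phi>(1), of B w] that B(3) by auto
  with \<phi> show ?thesis by (intro that[of \<phi>]) auto
qed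

section \<open>Invariance of truth and definable sets modulo an ultrafilter\<close>

lemma eval_term_cong:
  "(\<And>i. i \<in> fv_term t \<Longrightarrow> s i = s' i) \<Longrightarrow> eval_term M s t = eval_term M s' t"
proof (induction t)
  case (App f ts)
  then have "map (eval_term M s) ts = map (eval_term M s') ts" by auto
  then show ?case by (simp only: eval_term.simps)
qed simp

lemma sat_cong:
  "(\<And>i. i \<in> fv_form \<phi> \<Longrightarrow> s i = s' i) \<Longrightarrow> sat M s \<phi> \<longleftrightarrow> sat M s' \<phi>"
proof (induction \<phi> arbitrary: s s')
  case (Eq t u)
  then show ?case using eval_term_cong[of t s s' M] eval_term_cong[of u s s' M] by simp
next
  case (Neg \<phi>)
  from Neg.IH[of s s'] Neg.prems show ?case by simp
next
  case (Conj \<phi> \<psi>)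
  from Conj.IH(1)[of s s'] Conj.IH(2)[of s s'] Conj.prems show ?case by simp
next
  case (Ex i \<phi>)
  have "sat M (s(i := a)) \<phi> \<longleftrightarrow> sat M (s'(i := a)) \<phi>" for a
    by (rule Ex.IH) (use Ex.prems in auto)
  then show ?case by simp
qed

definition sequences :: "('f, 'a) struct \<Rightarrow> (nat \<Rightarrow> 'a) set" where
  "sequences M = {x. \<forall>n. x n \<in> universe M}"

text \<open>
  Working with sequences modulo \<open>U\<close> instead of the ultrapower, \<open>F\<close> stands for an automorphism of the
  ultrapower that lifts to an automorphism of the full power.
\<close>
locale power_automorphism =
  fixes M :: "('f, 'a) struct" and U :: "nat filter" and F :: "(nat \<Rightarrow> 'a) \<Rightarrow> nat \<Rightarrow> 'a"
  assumes ultra: "(\<forall>\<^sub>F n in U. \<not> P n) \<longleftrightarrow> \<not> (\<forall>\<^sub>F n in U. P n)"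
    and interp_closed: "length as = arity M f \<Longrightarrow> set as \<subseteq> universe M \<Longrightarrow> interp M f as \<in> universe M"
    and image_F: "F ` sequences M = sequences M"
    and F_interp: "length xs = arity M f \<Longrightarrow> set xs \<subseteq> sequences M \<Longrightarrow>
      F (\<lambda>n. interp M f (map (\<lambda>x. x n) xs)) = (\<lambda>n. interp M f (map (\<lambda>x. F x n) xs))"
    and F_eq_iff: "x \<in> sequences M \<Longrightarrow> y \<in> sequences M \<Longrightarrow>
      (\<forall>\<^sub>F n in U. F x n = F y n) \<longleftrightarrow> (\<forall>\<^sub>F n in U. x n = y n)"
    and F_const: "a \<in> universe M \<Longrightarrow> F (\<lambda>_. a) = (\<lambda>_. a)"
begin

text \<open>Both claims go through one induction: \<open>F_interp\<close> applies to a compound term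
  only if its arguments evaluate to sequences in the universe.\<close>

lemma eval_term_F:
  assumes "wf_term (arity M) t" "\<forall>i\<in>fv_term t. s i \<in> sequences M"
  shows "(\<lambda>n. eval_term M (\<lambda>i. s i n) t) \<in> sequences M \<and>
    F (\<lambda>n. eval_term M (\<lambda>i. s i n) t) = (\<lambda>n. eval_term M (\<lambda>i. F (s i) n) t)"
  using assms
proof (induction t)
  case (App f ts)
  define xs where "xs = map (\<lambda>t n. eval_term M (\<lambda>i. s i n) t) ts"
  have IH: "(\<lambda>n. eval_term M (\<lambda>i. s i n) t) \<in> sequences M"
    "F (\<lambda>n. eval_term M (\<lambda>i. s i n) t) = (\<lambda>n. eval_term M (\<lambda>i. F (s i) n) t)"
    if "t \<in> set ts" for t
    using App.IH[OF that] App.prems that by auto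
  have len: "length xs = arity M f" using App.prems by (simp add: xs_def)
  have xs: "set xs \<subseteq> sequences M" using IH(1) by (auto simp: xs_def)
  have "(\<lambda>n. interp M f (map (\<lambda>x. x n) xs)) \<in> sequences M"
    using len xs by (fastforce simp: sequences_def intro: interp_closed)
  moreover have "map (\<lambda>x. x n) xs = map (eval_term M (\<lambda>i. s i n)) ts" for n
    by (simp add: xs_def)
  moreover have "map (\<lambda>x. F x n) xs = map (eval_term M (\<lambda>i. F (s i) n)) ts" for n
    by (simp add: xs_def IH(2))
  ultimately show ?case using F_interp[OF len xs] by simp
qed simp

text \<open>An automorphism preserves truth in the ultrapower, argued as in the theorem of Los:
  \<open>F_eq_iff\<close> handles equations, \<open>ultra\<close> handles negation, and surjectivity
  of \<open>F\<close> on sequences handles the quantifier.\<close>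

lemma sat_F:
  assumes "wf_form (arity M) \<phi>" "\<forall>i\<in>fv_form \<phi>. s i \<in> sequences M"
  shows "(\<forall>\<^sub>F n in U. sat M (\<lambda>i. F (s i) n) \<phi>) \<longleftrightarrow> (\<forall>\<^sub>F n in U. sat M (\<lambda>i. s i n) \<phi>)"
  using assms
proof (induction \<phi> arbitrary: s)
  case (Eq t u)
  then show ?case
    using eval_term_F[of t s] eval_term_F[of u s]
      F_eq_iff[of "\<lambda>n. eval_term M (\<lambda>i. s i n) t" "\<lambda>n. eval_term M (\<lambda>i. s i n) u"]
    by auto
next
  case (Neg \<phi>)
  then show ?case by (simp add: ultra)
next
  case (Conj \<phi> \<psi>)
  then show ?case by (simp add: eventually_conj_iff)
next
  case (Ex i \<phi>)
  have witness: "(\<forall>\<^sub>F n in U. \<exists>a\<in>universe M. P n a) \<longleftrightarrow>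
      (\<exists>x\<in>sequences M. \<forall>\<^sub>F n in U. P n (x n))" for P
  proof
    assume ev: "\<forall>\<^sub>F n in U. \<exists>a\<in>universe M. P n a"
    \<comment> \<open>A default value is needed at the indices without a witness. It exists because
      \<open>ultra\<close> forces \<open>U\<close> to be proper.\<close>
    have "universe M \<noteq> {}"
    proof
      assume "universe M = {}"
      with ev have "\<forall>\<^sub>F n in U. False" by simp
      with ultra[of "\<lambda>_. True"] show False by simp
    qed
    then obtain a0 where a0: "a0 \<in> universe M" by blast
    define x where
      "x n = (if \<exists>a\<in>universe M. P n a then SOME a. a \<in> universe M \<and> P n a else a0)" for n
    have *: "x n \<in> universe M \<and> P n (x n)" if "\<exists>a\<in>universe M. P n a" for n
      using someI_ex[of "\<lambda>a. a \<in> universe M \<and> P n a"] that by (auto simp: x_def)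
    have "x n \<in> universe M" for n
      using *[of n] a0 by (cases "\<exists>a\<in>universe M. P n a") (auto simp: x_def)
    then have "x \<in> sequences M"
      by (simp add: sequences_def)
    moreover have "\<forall>\<^sub>F n in U. P n (x n)"
      using ev by eventually_elim (use * in blast)
    ultimately show "\<exists>x\<in>sequences M. \<forall>\<^sub>F n in U. P n (x n)" by blast
  next
    assume "\<exists>x\<in>sequences M. \<forall>\<^sub>F n in U. P n (x n)"
    then obtain x where x: "x \<in> sequences M" and "\<forall>\<^sub>F n in U. P n (x n)" by blast
    from this(2) show "\<forall>\<^sub>F n in U. \<exists>a\<in>universe M. P n a"
      by eventually_elim (use x in \<open>auto simp: sequences_def\<close>)
  qed
  have upd: "(\<lambda>j. (s(i := x)) j n) = (\<lambda>j. s j n)(i := x n)"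
    "(\<lambda>j. F ((s(i := x)) j) n) = (\<lambda>j. F (s j) n)(i := F x n)" for x n
    by auto
  have IH: "(\<forall>\<^sub>F n in U. sat M ((\<lambda>j. F (s j) n)(i := F x n)) \<phi>) \<longleftrightarrow>
      (\<forall>\<^sub>F n in U. sat M ((\<lambda>j. s j n)(i := x n)) \<phi>)" if "x \<in> sequences M" for x
    using Ex.IH[of "s(i := x)"] Ex.prems that unfolding upd by simp
  \<comment> \<open>Witnesses on the shifted side are sequences, and each of these has the form
    \<open>F x\<close>, which is what the induction hypothesis covers.\<close>
  have "(\<forall>\<^sub>F n in U. sat M (\<lambda>j. F (s j) n) (Ex i \<phi>)) \<longleftrightarrow>
      (\<exists>y\<in>F ` sequences M. \<forall>\<^sub>F n in U. sat M ((\<lambda>j. F (s j) n)(i := y n)) \<phi>)"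
    by (simp only: image_F sat.simps witness)
  also have "\<dots> \<longleftrightarrow> (\<exists>x\<in>sequences M. \<forall>\<^sub>F n in U. sat M ((\<lambda>j. s j n)(i := x n)) \<phi>)"
    using IH by auto
  also have "\<dots> \<longleftrightarrow> (\<forall>\<^sub>F n in U. sat M (\<lambda>j. s j n) (Ex i \<phi>))"
    by (simp only: sat.simps witness)
  finally show ?case .
qed

lemma definable_F:
  assumes "definable M k X" "length xs = k" "set xs \<subseteq> sequences M"
  shows "(\<forall>\<^sub>F n in U. map (\<lambda>x. F x n) xs \<in> X) \<longleftrightarrow> (\<forall>\<^sub>F n in U. map (\<lambda>x. x n) xs \<in> X)"
proof -
  obtain \<phi> ps where wf: "wf_form (arity M) \<phi>" and ps: "set ps \<subseteq> universe M"
    and fv: "fv_form \<phi> \<subseteq> {..<k + length ps}"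
    and X: "X = {ys. length ys = k \<and> set ys \<subseteq> universe M \<and> sat M (\<lambda>i. (ys @ ps) ! i) \<phi>}"
    using assms(1) unfolding definable_def by blast
  \<comment> \<open>Parameters enter as constant sequences, which \<open>F\<close> fixes.\<close>
  define zs where "zs = xs @ map (\<lambda>p _. p) ps"
  have zs: "set zs \<subseteq> sequences M" and len: "length zs = k + length ps"
    using assms ps by (auto simp: zs_def sequences_def)
  then have *: "\<forall>i\<in>fv_form \<phi>. zs ! i \<in> sequences M"
    using fv nth_mem by fastforce
  \<comment> \<open>Stated for a general \<open>G\<close> so that it serves both for
    \<open>F\<close> and for the identity.\<close>
  have mem: "map (\<lambda>x. G x n) xs \<in> X \<longleftrightarrow> sat M (\<lambda>i. G (zs ! i) n) \<phi>"
    if G: "\<And>x. x \<in> sequences M \<Longrightarrow> G x \<in> sequences M"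
      and G_const: "\<And>a. a \<in> universe M \<Longrightarrow> G (\<lambda>_. a) = (\<lambda>_. a)"
    for G :: "(nat \<Rightarrow> 'a) \<Rightarrow> nat \<Rightarrow> 'a" and n
  proof -
    have "(map (\<lambda>x. G x n) xs @ ps) ! i = G (zs ! i) n" if "i < k + length ps" for i
    proof (cases "i < k")
      case False
      then have "ps ! (i - k) \<in> universe M" using that ps nth_mem by fastforce
      then show ?thesis using that False assms(2) by (simp add: zs_def nth_append G_const)
    qed (use assms(2) in \<open>simp add: zs_def nth_append\<close>)
    then have "sat M (\<lambda>i. (map (\<lambda>x. G x n) xs @ ps) ! i) \<phi> \<longleftrightarrow> sat M (\<lambda>i. G (zs ! i) n) \<phi>"
      using fv by (intro sat_cong) auto
    moreover have "set (map (\<lambda>x. G x n) xs) \<subseteq> universe M"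
      using G assms(3) by (auto simp: sequences_def)
    ultimately show ?thesis using assms(2) by (simp add: X)
  qed
  have F_closed: "F x \<in> sequences M" if "x \<in> sequences M" for x
    using image_F that by blast
  show ?thesis
    using sat_F[OF wf *] mem[of F] mem[of "\<lambda>x. x"] F_closed F_const by simp
qed

end

section \<open>Twisting sequences in the Heisenberg group by a functional\<close>

definition shift_map :: "((nat \<Rightarrow> 'a) \<Rightarrow> 'a) \<Rightarrow> (nat \<Rightarrow> 'a::field ^ 3 ^ 3) \<Rightarrow> nat \<Rightarrow> 'a ^ 3 ^ 3" where
  "shift_map \<phi> x = (\<lambda>n. heis (x n $ 1 $ 2) (x n $ 2 $ 3) (x n $ 1 $ 3 + \<phi> (\<lambda>n. x n $ 1 $ 2)))"

lemma shift_map_heis: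
  "shift_map \<phi> (\<lambda>n. heis (a n) (b n) (c n)) = (\<lambda>n. heis (a n) (b n) (c n + \<phi> a))"
  by (simp add: shift_map_def heis_def)

lemma sequences_heisenberg:
  "x \<in> sequences (group_struct heisenberg_group) \<longleftrightarrow>
     (\<exists>a b c. x = (\<lambda>n. heis (a n) (b n) (c n)))"
  by (auto simp: sequences_def group_struct_def heisenberg_group_def fun_eq_iff) metis

text \<open>The first coordinate is additive under multiplication and the third one is central, so
  adding an additive function of the first to the third is a homomorphism; subtracting it gives the
  inverse. Vanishing on almost constant sequences makes the map respect equality modulo
  \<open>U\<close> and fix the diagonal.\<close>

lemma power_automorphism_shift_map:
  fixes \<phi> :: "(nat \<Rightarrow> 'a::field) \<Rightarrow> 'a"
  assumes ultra: "\<And>P. (\<forall>\<^sub>F n in U. \<not> P n) \<longleftrightarrow> \<not> (\<forall>\<^sub>F n in U. P n)"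
    and add: "\<And>x y. \<phi> (x + y) = \<phi> x + \<phi> y"
    and null: "\<And>x k. \<forall>\<^sub>F n in U. x n = k \<Longrightarrow> \<phi> x = 0"
  shows "power_automorphism (group_struct heisenberg_group) U (shift_map \<phi>)"
proof
  let ?H = "group_struct (heisenberg_group :: ('a ^ 3 ^ 3) monoid)"
  interpret group "heisenberg_group :: ('a ^ 3 ^ 3) monoid" by (rule group_heisenberg)
  have minus: "\<phi> (\<lambda>n. - x n) = - \<phi> x" for x
    using add[of x "\<lambda>n. - x n"] null[of "x + (\<lambda>n. - x n)" 0] by (simp add: add_eq_0_iff)
  have eq: "\<phi> x = \<phi> y" if "\<forall>\<^sub>F n in U. x n = y n" for x y
  proof -
    have "\<phi> (\<lambda>n. x n - y n) = 0"
      using that by (intro null[of _ 0]) (auto elim: eventually_mono)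
    moreover have "x = (\<lambda>n. x n - y n) + y" by auto
    ultimately show ?thesis using add[of "\<lambda>n. x n - y n" y] by simp
  qed
  show "(\<forall>\<^sub>F n in U. \<not> P n) \<longleftrightarrow> \<not> (\<forall>\<^sub>F n in U. P n)" for P by (rule ultra)
  show "interp ?H f as \<in> universe ?H" if "length as = arity ?H f" "set as \<subseteq> universe ?H" for f as
    using that by (cases f) (auto simp: group_struct_def numeral_2_eq_2 length_Suc_conv)
  show "shift_map \<phi> ` sequences ?H = sequences ?H"
  proof
    show "shift_map \<phi> ` sequences ?H \<subseteq> sequences ?H"
      by (fastforce simp: sequences_heisenberg shift_map_heis)
    show "sequences ?H \<subseteq> shift_map \<phi> ` sequences ?H"
    proof
      fix x assume "x \<in> sequences ?H"
      then obtain a b c where "x = (\<lambda>n. heis (a n) (b n) (c n))" by (auto simp: sequences_heisenberg)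
      then have "x = shift_map \<phi> (\<lambda>n. heis (a n) (b n) (c n - \<phi> a))"
        using shift_map_heis[of \<phi> a b "\<lambda>n. c n - \<phi> a"] by simp
      moreover have "(\<lambda>n. heis (a n) (b n) (c n - \<phi> a)) \<in> sequences ?H"
        unfolding sequences_heisenberg by (intro exI) (rule refl)
      ultimately show "x \<in> shift_map \<phi> ` sequences ?H" by blast
    qed
  qed
  show "shift_map \<phi> (\<lambda>n. interp ?H f (map (\<lambda>x. x n) xs)) =
      (\<lambda>n. interp ?H f (map (\<lambda>x. shift_map \<phi> x n) xs))"
    if len: "length xs = arity ?H f" and xs: "set xs \<subseteq> sequences ?H" for f xs
  proof (cases f)
    case GOne
    then show ?thesis
      using len shift_map_heis[of \<phi> "\<lambda>_. 0" "\<lambda>_. 0" "\<lambda>_. 0"] null[of "\<lambda>_. 0" 0]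
      by (simp add: group_struct_def heisenberg_group_def heis_one)
  next
    case GInv
    then obtain x where x: "xs = [x]" "x \<in> sequences ?H"
      using len xs by (auto simp: group_struct_def length_Suc_conv)
    then obtain a b c where "x = (\<lambda>n. heis (a n) (b n) (c n))" by (auto simp: sequences_heisenberg)
    then show ?thesis
      using GInv x(1) by (simp add: group_struct_def heis_inv shift_map_heis minus diff_diff_eq)
  next
    case GMult
    then obtain x y where xy: "xs = [x, y]" "x \<in> sequences ?H" "y \<in> sequences ?H"
      using len xs by (auto simp: group_struct_def numeral_2_eq_2 length_Suc_conv)
    then obtain a b c a' b' c' where "x = (\<lambda>n. heis (a n) (b n) (c n))"
      "y = (\<lambda>n. heis (a' n) (b' n) (c' n))" by (auto simp: sequences_heisenberg)
    then show ?thesis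
      using GMult xy(1) add[of a a']
      by (simp add: group_struct_def heisenberg_group_def heis_mult shift_map_heis plus_fun_def ac_simps)
  qed
  show "(\<forall>\<^sub>F n in U. shift_map \<phi> x n = shift_map \<phi> y n) \<longleftrightarrow> (\<forall>\<^sub>F n in U. x n = y n)"
    if x: "x \<in> sequences ?H" and y: "y \<in> sequences ?H" for x y
  proof -
    obtain a b c a' b' c' where xy: "x = (\<lambda>n. heis (a n) (b n) (c n))"
      "y = (\<lambda>n. heis (a' n) (b' n) (c' n))" using x y by (auto simp: sequences_heisenberg)
    show ?thesis
    \<comment> \<open>If the first coordinates agree almost everywhere, both shifts are equal and
      cancel; otherwise both sides fail, as first coordinates are not moved.\<close>
    proof (cases "\<forall>\<^sub>F n in U. a n = a' n")
      case True
      then show ?thesis by (simp add: xy shift_map_heis heis_inject eq[OF True])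
    next
      case False
      then show ?thesis by (simp add: xy shift_map_heis heis_inject eventually_conj_iff)
    qed
  qed
  show "shift_map \<phi> (\<lambda>_. h) = (\<lambda>_. h)" if h: "h \<in> universe ?H" for h
  proof -
    obtain a b c where "h = heis a b c"
      using h by (auto simp: group_struct_def heisenberg_group_def)
    then show ?thesis
      using shift_map_heis[of \<phi> "\<lambda>_. a" "\<lambda>_. b" "\<lambda>_. c"] null[of "\<lambda>_. a" a] by simp
  qed
qed

text \<open>Separates the three blocks that represent the coordinates of a matrix, so that the same
  block can later be used for all of them. The length assumption ensures that cutting a
  concatenation recovers its blocks.\<close>

lemma composite_standard_interpretation:
  assumes "\<forall>xs\<in>idom \<Delta>. length xs = dim \<Delta>"
  shows "{zs @ [coord (composite \<Delta> standard_interpretation) zs] | zs.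
      zs \<in> idom (composite \<Delta> standard_interpretation)} =
    {xs @ ys @ zs @ [heis (coord \<Delta> xs) (coord \<Delta> ys) (coord \<Delta> zs)] | xs ys zs.
      xs \<in> idom \<Delta> \<and> ys \<in> idom \<Delta> \<and> zs \<in> idom \<Delta>}" (is "?L = ?R")
proof -
  let ?\<Theta> = "composite \<Delta> standard_interpretation"
  have chunks3: "chunks (dim \<Delta>) 3 (xs @ ys @ zs) = [xs, ys, zs]"
    if "xs \<in> idom \<Delta>" "ys \<in> idom \<Delta>" "zs \<in> idom \<Delta>" for xs ys zs
    using chunks_concat[of "[xs, ys, zs]" 3 "dim \<Delta>"] that assms by simp
  show ?thesis
  proof
    show "?R \<subseteq> ?L"
    proof
      fix w assume "w \<in> ?R"
      then obtain xs ys zs where w: "w = xs @ ys @ zs @ [heis (coord \<Delta> xs) (coord \<Delta> ys) (coord \<Delta> zs)]"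
        and mem: "xs \<in> idom \<Delta>" "ys \<in> idom \<Delta>" "zs \<in> idom \<Delta>" by blast
      show "w \<in> ?L"
        using assms mem chunks3[OF mem]
        by (intro CollectI exI[of _ "xs @ ys @ zs"])
          (auto simp: w composite_def standard_interpretation_def)
    qed
    show "?L \<subseteq> ?R"
    proof
      fix w assume "w \<in> ?L"
      then obtain zs where w: "w = zs @ [coord ?\<Theta> zs]" and zs: "zs \<in> idom ?\<Theta>" by blast
      let ?d = "dim \<Delta>"
      define p q r where "p = take ?d zs" and "q = take ?d (drop ?d zs)" and "r = take ?d (drop (2 * ?d) zs)"
      have len: "length zs = 3 * ?d" and sub: "set (chunks ?d 3 zs) \<subseteq> idom \<Delta>"
        using zs by (auto simp: composite_def standard_interpretation_def)
      have ch: "chunks ?d 3 zs = [p, q, r]"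
        by (simp add: chunks_def p_def q_def r_def upt_rec numeral_2_eq_2)
      have "zs = p @ q @ r"
      proof -
        have "r = drop ?d (drop ?d zs)" using len by (simp add: r_def mult_2)
        then show ?thesis by (simp only: p_def q_def append_take_drop_id)
      qed
      then show "w \<in> ?R"
        using sub ch w by (auto simp: composite_def standard_interpretation_def)
    qed
  qed
qed

section \<open>Non-definability of the natural isomorphism of the Heisenberg group with its
  copy\<close>

theorem proposition4p2:
  assumes "infinite (UNIV :: 'a::field set)"
  shows "\<nexists>\<Delta> :: ('a ^ 3 ^ 3, 'a) interpr.
           bi_interpretation field_struct (group_struct heisenberg_group)
             standard_interpretation \<Delta>"
proof
  let ?H = "group_struct (heisenberg_group :: ('a ^ 3 ^ 3) monoid)"
  assume "\<exists>\<Delta> :: ('a ^ 3 ^ 3, 'a) interpr.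
    bi_interpretation field_struct ?H standard_interpretation \<Delta>"
  then obtain \<Delta> :: "('a ^ 3 ^ 3, 'a) interpr"
    where \<Delta>: "is_interpretation ?H field_struct \<Delta>"
      and iso: "natural_iso_definable ?H (composite \<Delta> standard_interpretation)"
    by (auto simp: bi_interpretation_def)
  have idom: "length xs = dim \<Delta>" "set xs \<subseteq> universe ?H" if "xs \<in> idom \<Delta>" for xs
    using \<Delta> that by (auto simp: is_interpretation_def definable_def)
  have "coord \<Delta> ` idom \<Delta> = UNIV"
    using \<Delta> by (simp add: is_interpretation_def field_struct_def)
  then have "\<forall>k. \<exists>xs. xs \<in> idom \<Delta> \<and> coord \<Delta> xs = k"
    by (metis UNIV_I imageE)
  then obtain rep where rep: "rep k \<in> idom \<Delta>" "coord \<Delta> (rep k) = k" for k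
    by metis
  define R where "R = {xs @ ys @ zs @ [heis (coord \<Delta> xs) (coord \<Delta> ys) (coord \<Delta> zs)] | xs ys zs.
      xs \<in> idom \<Delta> \<and> ys \<in> idom \<Delta> \<and> zs \<in> idom \<Delta>}"
  have R: "definable ?H (3 * dim \<Delta> + 1) R"
    using iso idom(1) composite_standard_interpretation[of \<Delta>]
    by (simp add: natural_iso_definable_def R_def) (simp add: composite_def standard_interpretation_def)

  obtain U :: "nat filter" where U: "U \<noteq> bot" "U \<le> sequentially"
    and ultra: "\<And>P. (\<forall>\<^sub>F n in U. \<not> P n) \<longleftrightarrow> \<not> (\<forall>\<^sub>F n in U. P n)"
    by (rule exists_ultrafilter_le[of sequentially]) auto
  obtain \<alpha> :: "nat \<Rightarrow> 'a" where \<alpha>: "inj \<alpha>"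
    using infinite_countable_subset[OF assms] by blast
  interpret V: vector_space "\<lambda>k x n. k * x n :: 'a"
    by unfold_locales (auto simp: algebra_simps)
  define W :: "(nat \<Rightarrow> 'a) set" where "W = {x. \<exists>k. \<forall>\<^sub>F n in U. x n = k}"
  have W: "V.subspace W"
  proof (rule V.subspaceI)
    show "0 \<in> W" unfolding W_def by (auto intro: exI[of _ 0])
    show "x + y \<in> W" if xy: "x \<in> W" "y \<in> W" for x y
    proof -
      obtain k l where "\<forall>\<^sub>F n in U. x n = k" "\<forall>\<^sub>F n in U. y n = l"
        using xy by (auto simp: W_def)
      then have "\<forall>\<^sub>F n in U. (x + y) n = k + l" by eventually_elim simp
      then show ?thesis by (auto simp: W_def)
    qed
    show "(\<lambda>n. c * x n) \<in> W" if x: "x \<in> W" for c x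
    proof -
      obtain k where "\<forall>\<^sub>F n in U. x n = k"
        using x by (auto simp: W_def)
      then have "\<forall>\<^sub>F n in U. c * x n = c * k" by eventually_elim simp
      then show ?thesis unfolding W_def by blast
    qed
  qed
  have "\<alpha> \<notin> W"
  proof
    assume "\<alpha> \<in> W"
    then obtain k where k: "\<forall>\<^sub>F n in U. \<alpha> n = k" by (auto simp: W_def)
    \<comment> \<open>By injectivity each value is taken at most once, and \<open>U\<close> contains
      all cofinite sets, so no value is taken almost everywhere.\<close>
    have "finite {n. \<alpha> n = k}"
      using finite_vimageI[OF _ \<alpha>, of "{k}"] by (simp add: vimage_def)
    then have "\<forall>\<^sub>F n in sequentially. \<alpha> n \<noteq> k"
      by (simp add: cofinite_eq_sequentially[symmetric] eventually_cofinite)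
    with U(2) have "\<forall>\<^sub>F n in U. \<alpha> n \<noteq> k" by (rule filter_leD)
    with k ultra show False by blast
  qed
  from V.exists_linear_functional[OF W this]
  obtain \<phi> where \<phi>: "Vector_Spaces.linear (\<lambda>k x n. k * x n) (*) \<phi>" "\<phi> \<alpha> = 1" "\<And>w. w \<in> W \<Longrightarrow> \<phi> w = 0"
    by blast
  interpret power_automorphism ?H U "shift_map \<phi>"
  proof (rule power_automorphism_shift_map[OF ultra])
    show "\<phi> (x + y) = \<phi> x + \<phi> y" for x y
      using \<phi>(1) by (rule Vector_Spaces.linear.axioms(3)[THEN module_hom.add])
    show "\<phi> x = 0" if "\<forall>\<^sub>F n in U. x n = k" for x k
      using that by (intro \<phi>(3)) (auto simp: W_def)
  qed

  \<comment> \<open>The tuples representing \<alpha> \<open>n\<close>, transposed: the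
    \<open>i\<close>-th sequence collects their \<open>i\<close>-th entries.\<close>
  define ys where "ys = map (\<lambda>i n. rep (\<alpha> n) ! i) [0..<dim \<Delta>]"
  define h where "h = (\<lambda>n. heis (\<alpha> n) (\<alpha> n) (\<alpha> n))"
  have ys: "map (\<lambda>y. y n) ys = rep (\<alpha> n)" for n
    using idom(1)[OF rep(1)] by (auto simp: ys_def o_def intro: nth_equalityI)
  have "rep (\<alpha> n) ! i \<in> universe ?H" if "i < dim \<Delta>" for n i
    using that idom[OF rep(1)] nth_mem by (metis subsetD)
  then have ys_seq: "set ys \<subseteq> sequences ?H" by (auto simp: ys_def sequences_def)
  have h_seq: "h \<in> sequences ?H" unfolding h_def sequences_heisenberg by blast
  have len: "length ys = dim \<Delta>" by (simp add: ys_def)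
  have "map (\<lambda>x. x n) (ys @ ys @ ys @ [h]) =
      rep (\<alpha> n) @ rep (\<alpha> n) @ rep (\<alpha> n) @ [heis (\<alpha> n) (\<alpha> n) (\<alpha> n)]" for n
    by (simp add: ys h_def)
  then have "map (\<lambda>x. x n) (ys @ ys @ ys @ [h]) \<in> R" for n
    unfolding R_def using rep[of "\<alpha> n"] by fastforce
  then have "\<forall>\<^sub>F n in U. map (\<lambda>x. x n) (ys @ ys @ ys @ [h]) \<in> R" by simp
  moreover have "length (ys @ ys @ ys @ [h]) = 3 * dim \<Delta> + 1" using len by simp
  moreover have "set (ys @ ys @ ys @ [h]) \<subseteq> sequences ?H" using ys_seq h_seq by simp
  ultimately have "\<forall>\<^sub>F n in U. map (\<lambda>x. shift_map \<phi> x n) (ys @ ys @ ys @ [h]) \<in> R"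
    using definable_F[OF R] by blast
  \<comment> \<open>Membership at a single index suffices; \<open>U\<close> is proper, so there is
    one.\<close>
  then obtain n where "map (\<lambda>x. shift_map \<phi> x n) (ys @ ys @ ys @ [h]) \<in> R"
    using U(1) eventually_happens by blast
  moreover define zs where "zs = map (\<lambda>x. shift_map \<phi> x n) ys"
  moreover have "length zs = dim \<Delta>" by (simp add: zs_def len)
  \<comment> \<open>The shift acts on each sequence separately, so the three equal blocks remain
    equal, and all blocks have length \<open>dim\<close> \<Delta>. The shifted matrix would thus
    have three equal coordinates, but its third is \<alpha> \<open>n + 1\<close> while its first is
    still \<alpha> \<open>n\<close>.\<close>
  ultimately have "shift_map \<phi> h n = heis (coord \<Delta> zs) (coord \<Delta> zs) (coord \<Delta> zs)"
    by (auto simp: R_def idom(1))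
  then show False
    by (auto simp: h_def shift_map_heis heis_inject \<phi>(2))
qed

end
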